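(* If $G = (\mathbb{Z}/2\mathbb{Z}) \wr \mathbb{Z}$ is the lamplighter group, then $\mathrm{Conj}_G(n) \preceq 2^{n^{n^2}}$.
   Context: Here $\wr$ is the restricted wreath product $A \wr B = \left(\bigoplus_{b \in B} A\right) \rtimes B$ with $B$ acting by $(b\cdot f)(x) = f(b^{-1}x)$ on finitely supported functions $f\colon B\to A$. A group $G$ is conjugacy separable if for all non-conjugate $g,h\in G$ there is a finite quotient of $G$ in which their images are not conjugate. For a finitely generated conjugacy separable group $G$ with a fixed finite generating set and associated word length $\|\cdot\|$, write $g^G$ for the conjugacy class of $g$, and for $h \notin g^G$ let $\mathrm{D}_G(g^G,h)$ be the minimum of $[G:N]$ over finite-index normal subgroups $N$ of $G$ such that the images of $g$ and $h$ are not conjugate in $G/N$; then $\mathrm{Conj}_G(n) = \max\{\mathrm{D}_G(g^G,h) : h \notin g^G,\ \|g\|,\|h\| \le n\}$. For nondecreasing $f,g\colon \mathbb{N}\to\mathbb{N}$, $f \preceq g$ means there is a constant $K \in \mathbb{N}$ with $f(n) \le K g(Kn)$ for all $n\in\mathbb{N}$. The $\preceq$-class of $\mathrm{Conj}_G$ does not depend on the finite generating set. *)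

theory Defs
  imports "HOL-Algebra.Algebra"
begin

section \<open>Restricted wreath products and the lamplighter group\<close>

definition translate :: "('b, 'd) monoid_scheme \<Rightarrow> 'b \<Rightarrow> ('b \<Rightarrow> 'a) \<Rightarrow> 'b \<Rightarrow> 'a" where
  "translate B b f = (\<lambda>x\<in>carrier B. f (inv\<^bsub>B\<^esub> b \<otimes>\<^bsub>B\<^esub> x))"

text \<open>The base group is the library's direct sum: the finitely supported functions from
  \<open>carrier B\<close> to \<open>carrier A\<close>, extended by \<open>undefined\<close> outside \<open>carrier B\<close>.\<close>

definition restricted_wreath ::
    "('a, 'c) monoid_scheme \<Rightarrow> ('b, 'd) monoid_scheme \<Rightarrow> (('b \<Rightarrow> 'a) \<times> 'b) monoid"
    (infixr \<open>wr\<close> 70) where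
  "A wr B =
    \<lparr>carrier = carrier (sum_group (carrier B) (\<lambda>_. A)) \<times> carrier B,
     monoid.mult = (\<lambda>(f, b) (f', b').
       (f \<otimes>\<^bsub>sum_group (carrier B) (\<lambda>_. A)\<^esub> translate B b f', b \<otimes>\<^bsub>B\<^esub> b')),
     one = (\<one>\<^bsub>sum_group (carrier B) (\<lambda>_. A)\<^esub>, \<one>\<^bsub>B\<^esub>)\<rparr>"

lemma translate_closed:
  assumes A: "group A" and B: "group B"
    and f: "f \<in> carrier (sum_group (carrier B) (\<lambda>_. A))" and b: "b \<in> carrier B"
  shows "translate B b f \<in> carrier (sum_group (carrier B) (\<lambda>_. A))"
proof -
  interpret B: group B by (rule B)
  have fin: "finite {x \<in> carrier B. f x \<noteq> \<one>\<^bsub>A\<^esub>}"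
    using f A by (simp add: carrier_sum_group)
  have "{x \<in> carrier B. f (inv\<^bsub>B\<^esub> b \<otimes>\<^bsub>B\<^esub> x) \<noteq> \<one>\<^bsub>A\<^esub>}
      \<subseteq> (\<lambda>y. b \<otimes>\<^bsub>B\<^esub> y) ` {x \<in> carrier B. f x \<noteq> \<one>\<^bsub>A\<^esub>}"
  proof
    fix x assume x: "x \<in> {x \<in> carrier B. f (inv\<^bsub>B\<^esub> b \<otimes>\<^bsub>B\<^esub> x) \<noteq> \<one>\<^bsub>A\<^esub>}"
    then have "x = b \<otimes>\<^bsub>B\<^esub> (inv\<^bsub>B\<^esub> b \<otimes>\<^bsub>B\<^esub> x)"
      using b by (simp add: B.m_assoc[symmetric])
    then show "x \<in> (\<lambda>y. b \<otimes>\<^bsub>B\<^esub> y) ` {x \<in> carrier B. f x \<noteq> \<one>\<^bsub>A\<^esub>}"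
      using x b by blast
  qed
  then have "finite {x \<in> carrier B. f (inv\<^bsub>B\<^esub> b \<otimes>\<^bsub>B\<^esub> x) \<noteq> \<one>\<^bsub>A\<^esub>}"
    using fin finite_surj by blast
  then have "finite {x \<in> carrier B. translate B b f x \<noteq> \<one>\<^bsub>A\<^esub>}"
    by (rule rev_finite_subset) (auto simp: translate_def)
  moreover have "translate B b f \<in> (\<Pi>\<^sub>E x\<in>carrier B. carrier A)"
    using f A b by (auto simp: carrier_sum_group translate_def PiE_iff)
  ultimately show ?thesis
    using A by (simp add: carrier_sum_group)
qed

lemma group_restricted_wreath:
  assumes A: "group A" and B: "group B"
  shows "group (A wr B)"
proof -
  let ?S = "sum_group (carrier B) (\<lambda>_. A)"
  interpret A: group A by (rule A)
  interpret B: group B by (rule B)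
  interpret S: group ?S by (rule sum_group) (rule A)
  have val: "f x \<in> carrier A" if "f \<in> carrier ?S" "x \<in> carrier B" for f x
    using that A by (auto simp: carrier_sum_group)
  have ext: "f \<in> extensional (carrier B)" if "f \<in> carrier ?S" for f
    using that A by (auto simp: carrier_sum_group PiE_iff)
  note tc = translate_closed[OF A B]
  have t_hom: "translate B b (f \<otimes>\<^bsub>?S\<^esub> f') = translate B b f \<otimes>\<^bsub>?S\<^esub> translate B b f'"
    if "b \<in> carrier B" for b f f'
    using that by (auto simp: translate_def)
  have t_comp: "translate B b (translate B b' f) = translate B (b \<otimes>\<^bsub>B\<^esub> b') f"
    if "b \<in> carrier B" "b' \<in> carrier B" for b b' f
    using that by (auto simp: translate_def B.inv_mult_group B.m_assoc)
  have t_one: "translate B \<one>\<^bsub>B\<^esub> f = f" if "f \<in> carrier ?S" for f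
    using ext[OF that] by (auto simp: translate_def extensional_def)
  have t_id: "translate B b \<one>\<^bsub>?S\<^esub> = \<one>\<^bsub>?S\<^esub>" if "b \<in> carrier B" for b
    using that by (auto simp: translate_def)
  show ?thesis
  proof (rule groupI)
    fix x y assume "x \<in> carrier (A wr B)" "y \<in> carrier (A wr B)"
    then show "x \<otimes>\<^bsub>A wr B\<^esub> y \<in> carrier (A wr B)"
      using tc S.m_closed by (auto simp: restricted_wreath_def simp del: mult_sum_group)
  next
    show "\<one>\<^bsub>A wr B\<^esub> \<in> carrier (A wr B)"
      using S.one_closed by (simp add: restricted_wreath_def)
  next
    fix x y z
    assume "x \<in> carrier (A wr B)" "y \<in> carrier (A wr B)" "z \<in> carrier (A wr B)"
    then show "x \<otimes>\<^bsub>A wr B\<^esub> y \<otimes>\<^bsub>A wr B\<^esub> z = x \<otimes>\<^bsub>A wr B\<^esub> (y \<otimes>\<^bsub>A wr B\<^esub> z)"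
      using tc
      by (auto simp: restricted_wreath_def t_hom t_comp S.m_assoc B.m_assoc simp del: mult_sum_group)
  next
    fix x assume "x \<in> carrier (A wr B)"
    then show "\<one>\<^bsub>A wr B\<^esub> \<otimes>\<^bsub>A wr B\<^esub> x = x"
      using S.l_one by (auto simp: restricted_wreath_def t_one simp del: mult_sum_group one_sum_group)
  next
    fix x assume "x \<in> carrier (A wr B)"
    then obtain f b where x: "x = (f, b)" and f: "f \<in> carrier ?S" and b: "b \<in> carrier B"
      by (auto simp: restricted_wreath_def)
    let ?y = "(translate B (inv\<^bsub>B\<^esub> b) (inv\<^bsub>?S\<^esub> f), inv\<^bsub>B\<^esub> b)"
    have "?y \<in> carrier (A wr B)"
      using tc[OF S.inv_closed[OF f] B.inv_closed[OF b]] b by (simp add: restricted_wreath_def)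
    moreover have "?y \<otimes>\<^bsub>A wr B\<^esub> x = \<one>\<^bsub>A wr B\<^esub>"
      using f b
      by (simp add: restricted_wreath_def x t_hom[symmetric] S.l_inv t_id
          del: mult_sum_group one_sum_group inv_sum_group)
    ultimately show "\<exists>y\<in>carrier (A wr B). y \<otimes>\<^bsub>A wr B\<^esub> x = \<one>\<^bsub>A wr B\<^esub>" by blast
  qed
qed

definition lamplighter_group :: "((int \<Rightarrow> int) \<times> int) monoid" where
  "lamplighter_group = integer_mod_group 2 wr integer_group"

lemma group_lamplighter_group: "group lamplighter_group"
  by (simp add: lamplighter_group_def group_restricted_wreath)


section \<open>Conjugacy separability and its quantification\<close>

definition conj_class :: "('a, 'b) monoid_scheme \<Rightarrow> 'a \<Rightarrow> 'a set" where
  "conj_class G g = {k \<otimes>\<^bsub>G\<^esub> g \<otimes>\<^bsub>G\<^esub> inv\<^bsub>G\<^esub> k | k. k \<in> carrier G}"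

definition separates_conj :: "('a, 'b) monoid_scheme \<Rightarrow> 'a set \<Rightarrow> 'a \<Rightarrow> 'a \<Rightarrow> bool" where
  "separates_conj G N g h \<longleftrightarrow>
     N \<lhd> G \<and> finite (rcosets\<^bsub>G\<^esub> N) \<and>
     N #>\<^bsub>G\<^esub> h \<notin> conj_class (G Mod N) (N #>\<^bsub>G\<^esub> g)"

definition conjugacy_separable :: "('a, 'b) monoid_scheme \<Rightarrow> bool" where
  "conjugacy_separable G \<longleftrightarrow>
     (\<forall>g\<in>carrier G. \<forall>h\<in>carrier G. h \<notin> conj_class G g \<longrightarrow> (\<exists>N. separates_conj G N g h))"

text \<open>\<open>conj_depth G g h\<close> is $D_G(g^G, h)$; it is meaningful only if some
  finite quotient separates the two classes.\<close>

definition conj_depth :: "('a, 'b) monoid_scheme \<Rightarrow> 'a \<Rightarrow> 'a \<Rightarrow> nat" where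
  "conj_depth G g h = (LEAST k. \<exists>N. separates_conj G N g h \<and> k = card (rcosets\<^bsub>G\<^esub> N))"

definition finite_generating_set :: "('a, 'b) monoid_scheme \<Rightarrow> 'a set \<Rightarrow> bool" where
  "finite_generating_set G S \<longleftrightarrow> finite S \<and> S \<subseteq> carrier G \<and> generate G S = carrier G"

text \<open>Words are over the letters of \<open>S\<close> and their inverses.\<close>

definition word_length :: "('a, 'b) monoid_scheme \<Rightarrow> 'a set \<Rightarrow> 'a \<Rightarrow> nat" where
  "word_length G S g =
     (LEAST n. \<exists>w. length w = n \<and> set w \<subseteq> S \<union> m_inv G ` S \<and> foldr (\<otimes>\<^bsub>G\<^esub>) w \<one>\<^bsub>G\<^esub> = g)"

text \<open>Inserting \<open>0\<close> fixes the value where no pair of non-conjugate elements of length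
  at most \<open>n\<close> exists, e.g. for \<open>n = 0\<close>; otherwise it does not affect the maximum.\<close>

definition Conj_fun :: "('a, 'b) monoid_scheme \<Rightarrow> 'a set \<Rightarrow> nat \<Rightarrow> nat" where
  "Conj_fun G S n = Max (insert 0 {conj_depth G g h | g h.
     g \<in> carrier G \<and> h \<in> carrier G \<and> h \<notin> conj_class G g \<and>
     word_length G S g \<le> n \<and> word_length G S h \<le> n})"

definition growth_le :: "(nat \<Rightarrow> nat) \<Rightarrow> (nat \<Rightarrow> nat) \<Rightarrow> bool" (infix \<open>\<preceq>\<close> 50) where
  "f \<preceq> g \<longleftrightarrow> (\<exists>K. \<forall>n. f n \<le> K * g (K * n))"

end

theory Submission
  imports Defs
begin

text \<open>An element \<open>(f, a)\<close> of the lamplighter group is a finite lamp configuration \<open>f\<close> together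
  with a shift \<open>a\<close>. Conjugation never changes \<open>a\<close>; it translates \<open>f\<close> by an arbitrary integer
  \<open>c\<close> and adds a coboundary, that is, a configuration of the form \<open>u(x) - u(x - a)\<close> modulo 2
  (\<open>lamplighter_conj_iff\<close>). For \<open>a \<noteq> 0\<close> the coboundaries are exactly the configurations whose sum
  over every residue class modulo \<open>a\<close> is even; the nontrivial inclusion is \<open>coboundary\<close>. So there
  are only three ways for \<open>(f, a)\<close> and \<open>(f', b)\<close> not to be conjugate: the shifts differ, or
  \<open>a = b = 0\<close> and \<open>f'\<close> is no translate of \<open>f\<close>, or \<open>a = b \<noteq> 0\<close> and the class sums of \<open>f'\<close>
  modulo \<open>a\<close> are no cyclic translate of those of \<open>f\<close>.

  Each of them is visible in a finite lamplighter group \<open>\<int>/2 wr \<int>/m\<close>, onto which class sums modulo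
  \<open>m\<close> give a homomorphism (\<open>reduce_mod_hom\<close>). In the third case \<open>m = \<bar>a\<bar>\<close> works by the
  description of the conjugacy classes. In the other two, suppose that the shifts and the supports
  lie in \<open>[-L, L]\<close>. Then any \<open>m > 4 * L\<close> works: two shifts that agree modulo \<open>m\<close> are equal, and
  two configurations that are cyclic translates of each other modulo \<open>m\<close> are translates of each
  other in \<open>\<int>\<close>, because nothing wraps around the circle (\<open>translate_of_class_sums\<close>).

  A word of length \<open>n\<close> gives \<open>L \<le> C * n\<close>, where \<open>C\<close> depends on the generating set only
  (\<open>confined_word_length\<close>). The quotient used has order \<open>m * 2 ^ m\<close> with
  \<open>m \<le> 4 * C * n + 1\<close>, so it is bounded by an exponential in \<open>n\<close>, and this lies far below
  the claimed bound.\<close>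

section \<open>Finite quotients and word length in arbitrary groups\<close>

text \<open>Free of inverses, so that the condition can be carried through a homomorphism and, in the
  lamplighter group, compared coordinate by coordinate.\<close>

lemma (in group) conj_class_iff:
  assumes "x \<in> carrier G" "y \<in> carrier G"
  shows "y \<in> conj_class G x \<longleftrightarrow> (\<exists>k\<in>carrier G. y \<otimes> k = k \<otimes> x)"
proof
  assume "y \<in> conj_class G x"
  then obtain k where "k \<in> carrier G" "y = k \<otimes> x \<otimes> inv k"
    by (auto simp: conj_class_def)
  with assms have "k \<in> carrier G" "y \<otimes> k = k \<otimes> x"
    by (auto simp: m_assoc)
  then show "\<exists>k\<in>carrier G. y \<otimes> k = k \<otimes> x" by blast
next
  assume "\<exists>k\<in>carrier G. y \<otimes> k = k \<otimes> x"
  then obtain k where k: "k \<in> carrier G" "y \<otimes> k = k \<otimes> x" by blast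
  with assms have "y = k \<otimes> x \<otimes> inv k"
    by (metis inv_solve_right m_closed)
  with k show "y \<in> conj_class G x"
    by (auto simp: conj_class_def)
qed

text \<open>A conjugator in \<open>G / ker h\<close> lifts to \<open>G\<close>, so a separation only has to be checked against the
  conjugators in \<open>h(G)\<close>.\<close>

lemma (in group_hom) separates_conj_kernel:
  assumes fin: "finite (carrier H)"
    and g: "g \<in> carrier G" and g': "g' \<in> carrier G"
    and sep: "\<And>k. k \<in> carrier G \<Longrightarrow> h g' \<otimes>\<^bsub>H\<^esub> h k \<noteq> h k \<otimes>\<^bsub>H\<^esub> h g"
  shows "separates_conj G (kernel G H h) g g'"
    and "card (rcosets (kernel G H h)) \<le> card (carrier H)"
proof -
  let ?N = "kernel G H h"
  interpret N: normal ?N G by (rule normal_kernel)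
  interpret Q: group "G Mod ?N" by (rule N.factorgroup_is_group)
  have cQ: "carrier (G Mod ?N) = rcosets ?N" by (simp add: FactGroup_def)
  have into: "(\<lambda>K. the_elem (h ` K)) ` (rcosets ?N) \<subseteq> carrier H"
    using FactGroup_the_elem_mem cQ by auto
  have inj: "inj_on (\<lambda>K. the_elem (h ` K)) (rcosets ?N)"
    using FactGroup_inj_on cQ by simp
  show "card (rcosets ?N) \<le> card (carrier H)"
    by (rule card_inj_on_le[OF inj into fin])
  have finN: "finite (rcosets ?N)"
    using inj_on_finite[OF inj into fin] .
  have "?N #> g' \<notin> conj_class (G Mod ?N) (?N #> g)"
  proof
    assume "?N #> g' \<in> conj_class (G Mod ?N) (?N #> g)"
    moreover have "?N #> g \<in> carrier (G Mod ?N)" "?N #> g' \<in> carrier (G Mod ?N)"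
      using g g' by (auto simp: carrier_FactGroup)
    ultimately obtain K where K: "K \<in> carrier (G Mod ?N)"
        "(?N #> g') \<otimes>\<^bsub>G Mod ?N\<^esub> K = K \<otimes>\<^bsub>G Mod ?N\<^esub> (?N #> g)"
      using Q.conj_class_iff by blast
    then obtain k where k: "k \<in> carrier G" "K = ?N #> k"
      by (auto simp: carrier_FactGroup)
    with K(2) g g' have "?N #> (g' \<otimes> k) = ?N #> (k \<otimes> g)"
      by (simp add: N.rcos_sum)
    moreover have "g' \<otimes> k \<in> ?N #> (g' \<otimes> k)"
      using k g' subgroup_kernel by (intro G.rcos_self) auto
    ultimately have "g' \<otimes> k \<in> ?N #> (k \<otimes> g)" by (rule subst)
    then obtain n where n: "n \<in> ?N" "g' \<otimes> k = n \<otimes> (k \<otimes> g)"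
      unfolding r_coset_def by blast
    from n(1) have nc: "n \<in> carrier G" "h n = \<one>\<^bsub>H\<^esub>" unfolding kernel_def by blast+
    have "h (g' \<otimes> k) = h n \<otimes>\<^bsub>H\<^esub> h (k \<otimes> g)"
      unfolding n(2) using nc k g by (intro hom_mult) auto
    then have "h g' \<otimes>\<^bsub>H\<^esub> h k = h k \<otimes>\<^bsub>H\<^esub> h g"
      using nc k g g' by simp
    with sep k show False by blast
  qed
  with finN show "separates_conj G ?N g g'"
    using normal_kernel by (simp add: separates_conj_def)
qed

lemma (in monoid) foldr_mult_append:
  assumes "set v \<subseteq> carrier G" "set w \<subseteq> carrier G"
  shows "foldr (\<otimes>) (v @ w) \<one> = foldr (\<otimes>) v \<one> \<otimes> foldr (\<otimes>) w \<one>"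
proof -
  have cl: "foldr (\<otimes>) u \<one> \<in> carrier G" if "set u \<subseteq> carrier G" for u
    using that by (induction u) auto
  show ?thesis
    using assms(1) by (induction v) (auto simp: m_assoc cl assms(2))
qed

lemma (in group) generate_imp_word:
  assumes S: "S \<subseteq> carrier G" and "g \<in> generate G S"
  shows "\<exists>w. set w \<subseteq> S \<union> m_inv G ` S \<and> foldr (\<otimes>) w \<one> = g"
  using assms(2)
proof induction
  case one
  then show ?case by (intro exI[of _ "[]"]) auto
next
  case (incl h)
  then show ?case using S by (intro exI[of _ "[h]"]) auto
next
  case (inv h)
  then show ?case using S by (intro exI[of _ "[inv h]"]) auto
next
  case (eng h1 h2)
  then obtain v w where "set v \<subseteq> S \<union> m_inv G ` S" "foldr (\<otimes>) v \<one> = h1"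
    "set w \<subseteq> S \<union> m_inv G ` S" "foldr (\<otimes>) w \<one> = h2" by blast
  moreover have "S \<union> m_inv G ` S \<subseteq> carrier G" using S by auto
  ultimately show ?case
    using foldr_mult_append[of v w] by (intro exI[of _ "v @ w"]) auto
qed

lemma (in group) word_of_word_length:
  assumes "finite_generating_set G S" and "g \<in> carrier G"
  obtains w where "length w = word_length G S g" "set w \<subseteq> S \<union> m_inv G ` S"
    "foldr (\<otimes>) w \<one> = g"
proof -
  have "\<exists>n w. length w = n \<and> set w \<subseteq> S \<union> m_inv G ` S \<and> foldr (\<otimes>) w \<one> = g"
    using generate_imp_word[of S g] assms by (auto simp: finite_generating_set_def)
  then have "\<exists>w. length w = word_length G S g \<and> set w \<subseteq> S \<union> m_inv G ` S \<and> foldr (\<otimes>) w \<one> = g"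
    unfolding word_length_def by (rule LeastI_ex)
  then show thesis using that by blast
qed

section \<open>The lamplighter group in coordinates\<close>

definition lamp_configs :: "(int \<Rightarrow> int) set" where
  "lamp_configs = {f. (\<forall>x. f x \<in> {0, 1}) \<and> finite {x. f x \<noteq> 0}}"

lemma lamp_configs_cases: "f \<in> lamp_configs \<Longrightarrow> f x = 0 \<or> f x = 1"
  by (auto simp: lamp_configs_def)

lemma lamp_configs_mod_2: "f \<in> lamp_configs \<Longrightarrow> f x mod 2 = f x"
  using lamp_configs_cases[of f x] by auto

lemma carrier_lamplighter: "carrier lamplighter_group = lamp_configs \<times> UNIV"
proof -
  have "(x \<in> {0..<2}) = (x \<in> {0, 1})" for x :: int by auto
  then show ?thesis
    by (auto simp: lamplighter_group_def restricted_wreath_def carrier_sum_group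
      carrier_integer_mod_group lamp_configs_def PiE_iff)
qed

lemma mult_lamplighter:
  "(f, a) \<otimes>\<^bsub>lamplighter_group\<^esub> (g, b) = (\<lambda>x. (f x + g (x - a)) mod 2, a + b)"
  by (auto simp: lamplighter_group_def restricted_wreath_def translate_def algebra_simps)

lemma one_lamplighter: "\<one>\<^bsub>lamplighter_group\<^esub> = (\<lambda>x. 0, 0)"
  by (auto simp: lamplighter_group_def restricted_wreath_def)

text \<open>The conjugator is \<open>(u, c)\<close>. Modulo 2 the equation says that \<open>f'\<close> differs from the translate of
  \<open>f\<close> by \<open>c\<close> in the coboundary \<open>u(x) - u(x - b)\<close>.\<close>

lemma lamplighter_conj_iff:
  assumes "f \<in> lamp_configs" "f' \<in> lamp_configs"
  shows "(f', b) \<in> conj_class lamplighter_group (f, a) \<longleftrightarrow>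
    a = b \<and> (\<exists>c. \<exists>u\<in>lamp_configs. \<forall>x. (f' x + u (x - b)) mod 2 = (u x + f (x - c)) mod 2)"
proof -
  interpret group lamplighter_group by (rule group_lamplighter_group)
  have "(f', b) \<in> conj_class lamplighter_group (f, a) \<longleftrightarrow>
      (\<exists>k\<in>carrier lamplighter_group. (f', b) \<otimes>\<^bsub>lamplighter_group\<^esub> k
         = k \<otimes>\<^bsub>lamplighter_group\<^esub> (f, a))"
    using assms by (intro conj_class_iff) (auto simp: carrier_lamplighter)
  then show ?thesis
    by (auto simp: carrier_lamplighter mult_lamplighter fun_eq_iff)
qed

section \<open>Reduction onto finite lamplighter groups\<close>

text \<open>The summation runs over the support of \<open>f\<close>, as sums over infinite sets are \<open>0\<close>. The residue
  class is given by an arbitrary integer \<open>r\<close>, which makes class sums periodic functions on \<open>\<int>\<close>, so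
  that they can be translated without reducing the argument modulo \<open>m\<close>.\<close>

definition class_sum :: "int \<Rightarrow> (int \<Rightarrow> int) \<Rightarrow> int \<Rightarrow> int" where
  "class_sum m f r = (\<Sum>x | f x \<noteq> 0 \<and> x mod m = r mod m. f x) mod 2"

text \<open>For comparing class sums of configurations with different supports.\<close>

lemma class_sum_superset:
  assumes "finite F" "{x. f x \<noteq> 0} \<subseteq> F"
  shows "class_sum m f r = (\<Sum>x\<in>F. if x mod m = r mod m then f x else 0) mod 2"
proof -
  have "(\<Sum>x | f x \<noteq> 0 \<and> x mod m = r mod m. f x) = (\<Sum>x\<in>F. if x mod m = r mod m then f x else 0)"
    using assms by (intro sum.mono_neutral_cong_left) auto
  then show ?thesis by (simp add: class_sum_def)
qed

lemma class_sum_periodic: "r mod m = s mod m \<Longrightarrow> class_sum m f r = class_sum m f s"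
  by (simp add: class_sum_def)

lemma class_sum_mod [simp]: "class_sum m f (r mod m) = class_sum m f r"
  by (simp add: class_sum_def)

lemma class_sum_bound: "0 \<le> class_sum m f r" "class_sum m f r < 2"
  by (auto simp: class_sum_def)

lemma class_sum_add:
  assumes "finite {x. f x \<noteq> 0}" "finite {x. g x \<noteq> 0}"
  shows "class_sum m (\<lambda>x. (f x + g x) mod 2) r = (class_sum m f r + class_sum m g r) mod 2"
proof -
  let ?F = "{x. f x \<noteq> 0} \<union> {x. g x \<noteq> 0}"
  let ?on = "\<lambda>p x. if x mod m = r mod m then p x else (0::int)"
  have "class_sum m (\<lambda>x. (f x + g x) mod 2) r = (\<Sum>x\<in>?F. ?on (\<lambda>x. (f x + g x) mod 2) x) mod 2"
    using assms by (intro class_sum_superset) auto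
  also have "\<dots> = (\<Sum>x\<in>?F. ?on (\<lambda>x. (f x + g x) mod 2) x mod 2) mod 2"
    by (simp add: mod_sum_eq)
  also have "\<dots> = (\<Sum>x\<in>?F. (?on f x + ?on g x) mod 2) mod 2"
    by (rule arg_cong[of _ _ "\<lambda>s. s mod 2"], rule sum.cong) simp_all
  also have "\<dots> = (\<Sum>x\<in>?F. ?on f x + ?on g x) mod 2"
    by (simp add: mod_sum_eq)
  also have "\<dots> = ((\<Sum>x\<in>?F. ?on f x) mod 2 + (\<Sum>x\<in>?F. ?on g x) mod 2) mod 2"
    by (simp add: sum.distrib mod_add_eq)
  also have "\<dots> = (class_sum m f r + class_sum m g r) mod 2"
    using assms by (subst (1 2) class_sum_superset[of ?F]) auto
  finally show ?thesis .
qed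

lemma class_sum_shift: "class_sum m (\<lambda>x. f (x - c)) r = class_sum m f (r - c)"
proof -
  have iff: "(x + c) mod m = r mod m \<longleftrightarrow> x mod m = (r - c) mod m" for x
    by (simp add: mod_eq_dvd_iff algebra_simps)
  have "(\<Sum>x | f x \<noteq> 0 \<and> x mod m = (r - c) mod m. f x)
      = (\<Sum>x | f (x - c) \<noteq> 0 \<and> x mod m = r mod m. f (x - c))"
    by (rule sum.reindex_bij_witness[of _ "\<lambda>x. x - c" "\<lambda>x. x + c"])
       (auto simp: iff, simp add: iff[symmetric])
  then show ?thesis by (simp add: class_sum_def)
qed

lemma finite_support_shift:
  fixes f :: "int \<Rightarrow> int"
  assumes "finite {x. f x \<noteq> 0}"
  shows "finite {x. f (x - c) \<noteq> 0}"
proof (rule finite_subset)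
  show "{x. f (x - c) \<noteq> 0} \<subseteq> (\<lambda>x. x + c) ` {x. f x \<noteq> 0}"
    by (auto intro!: image_eqI[where x = "x - c" for x])
qed (use assms in simp)

abbreviation finite_lamplighter :: "nat \<Rightarrow> ((int \<Rightarrow> int) \<times> int) monoid" where
  "finite_lamplighter m \<equiv> integer_mod_group 2 wr integer_mod_group m"

definition reduce_mod :: "nat \<Rightarrow> (int \<Rightarrow> int) \<times> int \<Rightarrow> (int \<Rightarrow> int) \<times> int" where
  "reduce_mod m = (\<lambda>(f, a). (\<lambda>r\<in>{0..<int m}. class_sum (int m) f r, a mod int m))"

lemma carrier_finite_lamplighter:
  assumes "m > 0"
  shows "carrier (finite_lamplighter m) = ({0..<int m} \<rightarrow>\<^sub>E {0..<2}) \<times> {0..<int m}"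
proof -
  have "finite {i. 0 \<le> i \<and> i < int m \<and> f i \<noteq> 0}" for f :: "int \<Rightarrow> int"
    by (rule finite_subset[of _ "{0..<int m}"]) auto
  then show ?thesis
    using assms
    by (simp add: restricted_wreath_def carrier_sum_group carrier_integer_mod_group)
qed

lemma order_finite_lamplighter:
  assumes "m > 0"
  shows "card (carrier (finite_lamplighter m)) = m * 2 ^ m" "finite (carrier (finite_lamplighter m))"
  using assms by (auto simp: carrier_finite_lamplighter card_cartesian_product card_PiE finite_PiE)

lemma mult_finite_lamplighter:
  assumes "m > 0" "b \<in> {0..<int m}"
  shows "(f, b) \<otimes>\<^bsub>finite_lamplighter m\<^esub> (f', b')
    = (\<lambda>r\<in>{0..<int m}. (f r + f' ((r - b) mod int m)) mod 2, (b + b') mod int m)"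
proof -
  have "inv\<^bsub>integer_mod_group m\<^esub> b = (- b) mod int m"
    using assms by (intro inv_integer_mod_group) (auto simp: carrier_integer_mod_group)
  moreover have "((- b) mod int m + r) mod int m = (r - b) mod int m" for r
    by (simp add: mod_add_left_eq)
  ultimately show ?thesis
    using assms by (auto simp: restricted_wreath_def translate_def carrier_integer_mod_group)
qed

lemma reduce_mod_mult:
  assumes "m > 0"
  shows "reduce_mod m (f, a) \<otimes>\<^bsub>finite_lamplighter m\<^esub> reduce_mod m (g, b)
    = (\<lambda>r\<in>{0..<int m}. (class_sum (int m) f r + class_sum (int m) g (r - a)) mod 2, (a + b) mod int m)"
proof -
  have "class_sum (int m) g ((r - a mod int m) mod int m) = class_sum (int m) g (r - a)" for r
    by (simp add: mod_diff_right_eq)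
  then show ?thesis
    using assms
    by (auto simp: reduce_mod_def mult_finite_lamplighter mod_add_eq intro!: restrict_ext)
qed

lemma reduce_mod_hom:
  assumes "m > 0"
  shows "group_hom lamplighter_group (finite_lamplighter m) (reduce_mod m)"
proof (intro group_hom.intro group_hom_axioms.intro homI)
  show "group lamplighter_group" by (rule group_lamplighter_group)
  show "group (finite_lamplighter m)" by (simp add: group_restricted_wreath)
  fix x assume "x \<in> carrier lamplighter_group"
  then show "reduce_mod m x \<in> carrier (finite_lamplighter m)"
    using assms class_sum_bound
    by (auto simp: carrier_finite_lamplighter reduce_mod_def carrier_lamplighter)
next
  fix x y assume "x \<in> carrier lamplighter_group" "y \<in> carrier lamplighter_group"
  then obtain f a g b where xy: "x = (f, a)" "y = (g, b)"
    and fg: "f \<in> lamp_configs" "g \<in> lamp_configs" by (auto simp: carrier_lamplighter)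
  have "finite {x. f x \<noteq> 0}" "finite {x. g (x - a) \<noteq> 0}"
    using fg finite_support_shift by (auto simp: lamp_configs_def)
  then have "class_sum m (\<lambda>x. (f x + g (x - a)) mod 2) r
      = (class_sum m f r + class_sum m g (r - a)) mod 2" for r
    by (simp add: class_sum_add class_sum_shift)
  then show "reduce_mod m (x \<otimes>\<^bsub>lamplighter_group\<^esub> y)
      = reduce_mod m x \<otimes>\<^bsub>finite_lamplighter m\<^esub> reduce_mod m y"
    unfolding xy using assms fg
    by (simp add: reduce_mod_mult)
       (auto simp: reduce_mod_def mult_lamplighter intro!: restrict_ext)
qed

text \<open>If \<open>m\<close> divides the shift, then a coboundary \<open>u(x) - u(x - b)\<close> has vanishing class sums modulo
  \<open>m\<close>, so that a conjugator acts on class sums by translation alone.\<close>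

lemma reduce_mod_conjD:
  assumes m: "m > 0"
    and eq: "reduce_mod m (f', b) \<otimes>\<^bsub>finite_lamplighter m\<^esub> reduce_mod m (u, c)
      = reduce_mod m (u, c) \<otimes>\<^bsub>finite_lamplighter m\<^esub> reduce_mod m (f, a)"
  shows "int m dvd b - a"
    and "int m dvd b \<Longrightarrow> class_sum (int m) f' r = class_sum (int m) f (r - c)"
proof -
  have *: "(b + c) mod int m = (c + a) mod int m"
    "\<And>r. r \<in> {0..<int m} \<Longrightarrow> (class_sum m f' r + class_sum m u (r - b)) mod 2
      = (class_sum m u r + class_sum m f (r - c)) mod 2"
    using eq m by (auto simp: reduce_mod_mult fun_eq_iff restrict_def split: if_splits)
  from *(1) show "int m dvd b - a"
    by (simp add: mod_eq_dvd_iff)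
  assume b: "int m dvd b"
  let ?r = "r mod int m"
  have "?r \<in> {0..<int m}" using m by simp
  note *(2)[OF this]
  moreover have "class_sum m u (?r - b) = class_sum m u ?r"
  proof (rule class_sum_periodic)
    have "(?r - b) mod int m = (?r - b mod int m) mod int m" by (simp add: mod_diff_right_eq)
    then show "(?r - b) mod int m = ?r mod int m" using b by simp
  qed
  moreover have "class_sum m f (?r - c) = class_sum m f (r - c)"
    by (intro class_sum_periodic) (simp add: mod_diff_left_eq)
  ultimately show "class_sum m f' r = class_sum m f (r - c)"
    using class_sum_bound[of m f' r] class_sum_bound[of m f "r - c"] by simp presburger
qed

section \<open>Configurations and their class sums\<close>

text \<open>A point of \<open>[-3 * L, 3 * L]\<close> and a point of \<open>[-L, L]\<close> are at most \<open>4 * L\<close> apart, hence equal if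
  they agree modulo \<open>4 * L + 1\<close>. The window is wider than the support, so as to contain the
  supports of the translates of \<open>f\<close> by at most \<open>2 * L\<close>.\<close>

lemma class_sum_confined:
  assumes "f \<in> lamp_configs" and supp: "\<And>x. f x \<noteq> 0 \<Longrightarrow> \<bar>x\<bar> \<le> L" and "\<bar>x\<bar> \<le> 3 * L"
  shows "class_sum (4 * L + 1) f x = f x"
proof -
  have "y = x" if "f y \<noteq> 0" "y mod (4 * L + 1) = x mod (4 * L + 1)" for y
  proof (rule ccontr)
    assume "y \<noteq> x"
    moreover have "4 * L + 1 dvd y - x" using that by (simp add: mod_eq_dvd_iff)
    ultimately have "4 * L + 1 \<le> \<bar>y - x\<bar>"
      using dvd_imp_le_int[of "y - x" "4 * L + 1"] by auto
    with supp[OF that(1)] assms(3) show False by linarith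
  qed
  then have "{y. f y \<noteq> 0 \<and> y mod (4 * L + 1) = x mod (4 * L + 1)} = (if f x = 0 then {} else {x})"
    by auto
  then show ?thesis
    using lamp_configs_mod_2[OF assms(1)] by (simp add: class_sum_def)
qed

text \<open>Matching one lamp of \<open>f\<close> with a lamp of \<open>f'\<close> in the class prescribed by \<open>c\<close> replaces \<open>c\<close> by a
  representative \<open>d\<close> modulo \<open>4 * L + 1\<close> with \<open>\<bar>d\<bar> \<le> 2 * L\<close>. Inside the window the class sums are the
  configurations themselves, and outside of it both sides vanish.\<close>

lemma translate_of_class_sums:
  assumes f: "f \<in> lamp_configs" and f': "f' \<in> lamp_configs"
    and supp: "\<And>x. f x \<noteq> 0 \<Longrightarrow> \<bar>x\<bar> \<le> L" and supp': "\<And>x. f' x \<noteq> 0 \<Longrightarrow> \<bar>x\<bar> \<le> L"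
    and L: "L \<ge> 0"
    and eq: "\<And>r. class_sum (4 * L + 1) f' r = class_sum (4 * L + 1) f (r - c)"
  shows "\<exists>d. \<forall>x. f' x = f (x - d)"
proof (cases "\<exists>x. f x \<noteq> 0")
  case False
  then have "class_sum (4 * L + 1) f r = 0" for r by (simp add: class_sum_def)
  then have "f' x = 0" for x
    using class_sum_confined[OF f' supp', of x] supp'[of x] eq L by fastforce
  with False show ?thesis by auto
next
  case True
  then obtain x where x: "f x \<noteq> 0" by blast
  let ?m = "4 * L + 1"
  have "class_sum ?m f' (x + c) = f x"
    using eq class_sum_confined[OF f supp, of x] supp[OF x] by simp
  with x have "{y. f' y \<noteq> 0 \<and> y mod ?m = (x + c) mod ?m} \<noteq> {}"
    unfolding class_sum_def by (metis mod_0 sum.empty)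
  then obtain y where y: "f' y \<noteq> 0" "y mod ?m = (x + c) mod ?m" by blast
  define d where "d = y - x"
  have shift: "class_sum ?m f' r = class_sum ?m f (r - d)" for r
  proof -
    have "(r - c) mod ?m = (r - d) mod ?m"
      using y(2) by (simp add: d_def mod_eq_dvd_iff algebra_simps)
    then show ?thesis using eq class_sum_periodic by metis
  qed
  have d: "\<bar>d\<bar> \<le> 2 * L" using supp[OF x] supp'[OF y(1)] by (simp add: d_def)
  have "f' z = f (z - d)" for z
  proof (cases "\<bar>z\<bar> \<le> 3 * L \<and> \<bar>z - d\<bar> \<le> 3 * L")
    case True
    then show ?thesis
      using shift[of z] class_sum_confined[OF f supp] class_sum_confined[OF f' supp'] by simp
  next
    case False
    with d L have "\<not> \<bar>z\<bar> \<le> L" "\<not> \<bar>z - d\<bar> \<le> L" by linarith+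
    then show ?thesis using supp supp' by metis
  qed
  then show ?thesis by blast
qed

text \<open>The partial sums of \<open>v\<close> along each residue class, taken from \<open>-\<infinity>\<close>, solve the equation. They
  vanish far to the left since \<open>v\<close> has finite support, and far to the right since there they are
  the full class sums; hence the solution has finite support.\<close>

lemma coboundary_pos:
  assumes v: "v \<in> lamp_configs" and a: "a > 0" and zero: "\<And>r. class_sum a v r = 0"
  shows "\<exists>u\<in>lamp_configs. \<forall>x. u x = (u (x - a) + v x) mod 2"
proof -
  define F where "F = {x. v x \<noteq> 0}"
  have fin: "finite F" using v by (simp add: F_def lamp_configs_def)
  define s where "s x = (\<Sum>y\<in>F. if y \<le> x \<and> y mod a = x mod a then v y else 0)" for x
  define u where "u x = s x mod 2" for x
  have step: "s x = s (x - a) + v x" for x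
  proof -
    have "s x = (\<Sum>y\<in>F. (if y \<le> x - a \<and> y mod a = (x - a) mod a then v y else 0)
        + (if y = x then v y else 0))"
      unfolding s_def
    proof (intro sum.cong refl)
      fix y
      have "y \<le> x - a \<or> y = x" if "y \<le> x" "y mod a = x mod a"
      proof -
        have "a dvd x - y" using that by (metis mod_eq_dvd_iff)
        then show ?thesis using zdvd_imp_le[of a "x - y"] that by linarith
      qed
      then show "(if y \<le> x \<and> y mod a = x mod a then v y else 0)
        = (if y \<le> x - a \<and> y mod a = (x - a) mod a then v y else 0) + (if y = x then v y else 0)"
        using a by auto
    qed
    also have "\<dots> = s (x - a) + v x"
      using fin by (simp add: sum.distrib s_def F_def)
    finally show ?thesis .
  qed
  obtain l where l: "\<And>y. y \<in> F \<Longrightarrow> l \<le> y" using bdd_below_finite[OF fin] by (auto simp: bdd_below_def)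
  obtain h where h: "\<And>y. y \<in> F \<Longrightarrow> y \<le> h" using bdd_above_finite[OF fin] by (auto simp: bdd_above_def)
  have "u x = 0" if "x \<notin> {l..h}" for x
  proof (cases "x < l")
    case True
    then have "s x = 0" unfolding s_def using l by (intro sum.neutral) force
    then show ?thesis by (simp add: u_def)
  next
    case False
    with that have "s x = (\<Sum>y\<in>F. if y mod a = x mod a then v y else 0)"
      unfolding s_def using h by (intro sum.cong) force+
    then have "u x = class_sum a v x"
      using class_sum_superset[OF fin, of v a x] by (simp add: u_def F_def)
    with zero show ?thesis by simp
  qed
  then have "{x. u x \<noteq> 0} \<subseteq> {l..h}" by blast
  then have "finite {x. u x \<noteq> 0}" by (rule finite_subset) simp
  moreover have "u x \<in> {0, 1}" for x by (auto simp: u_def)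
  ultimately have "u \<in> lamp_configs" by (simp add: lamp_configs_def)
  moreover have "u x = (u (x - a) + v x) mod 2" for x
    using step[of x] by (simp add: u_def mod_add_left_eq)
  ultimately show ?thesis by blast
qed

lemma coboundary:
  assumes v: "v \<in> lamp_configs" and a: "a \<noteq> 0" and zero: "\<And>r. class_sum \<bar>a\<bar> v r = 0"
  shows "\<exists>u\<in>lamp_configs. \<forall>x. u x = (u (x - a) + v x) mod 2"
proof (cases "a > 0")
  case True
  then show ?thesis using coboundary_pos[OF v] zero by simp
next
  case False
  \<comment> \<open>Shifting the solution for \<open>-a\<close> by \<open>a\<close> gives the equation for \<open>a\<close> up to the sign of \<open>v\<close>,
    which is irrelevant modulo 2.\<close>
  with a zero coboundary_pos[OF v, of "- a"] obtain u
    where u: "u \<in> lamp_configs" "\<And>x. u x = (u (x + a) + v x) mod 2" by auto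
  define w where "w x = u (x + a)" for x
  have "w \<in> lamp_configs"
    using u(1) finite_support_shift[of u "- a"] by (simp add: w_def lamp_configs_def)
  moreover have "w x = (w (x - a) + v x) mod 2" for x
    using u(2)[of x] lamp_configs_cases[OF u(1), of "x + a"] lamp_configs_cases[OF u(1), of x]
      lamp_configs_cases[OF v, of x] by (auto simp: w_def)
  ultimately show ?thesis by blast
qed

section \<open>Separating conjugacy classes\<close>

definition confined :: "int \<Rightarrow> (int \<Rightarrow> int) \<times> int \<Rightarrow> bool" where
  "confined L = (\<lambda>(f, a). \<bar>a\<bar> \<le> L \<and> (\<forall>x. f x \<noteq> 0 \<longrightarrow> \<bar>x\<bar> \<le> L))"

text \<open>Equal nonzero shifts call for the modulus \<open>\<bar>a\<bar>\<close>, modulo which every coboundary vanishes. In all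
  other cases the modulus must exceed \<open>\<bar>b - a\<bar> \<le> 2 * L\<close>, in order to tell the shifts apart, and
  \<open>4 * L\<close>, in order to tell translates from cyclic translates.\<close>

lemma conj_of_reduce_mod_conj:
  assumes "confined L (f, a)" "confined L (f', b)" and L: "L \<ge> 0"
    and f: "f \<in> lamp_configs" and f': "f' \<in> lamp_configs"
    and m: "m = (if a = b \<and> a \<noteq> 0 then nat \<bar>a\<bar> else nat (4 * L + 1))"
    and eq: "reduce_mod m (f', b) \<otimes>\<^bsub>finite_lamplighter m\<^esub> reduce_mod m (u, c)
      = reduce_mod m (u, c) \<otimes>\<^bsub>finite_lamplighter m\<^esub> reduce_mod m (f, a)"
  shows "(f', b) \<in> conj_class lamplighter_group (f, a)"
proof -
  have m0: "m > 0" using m L by auto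
  note D = reduce_mod_conjD[OF m0 eq]
  have "\<bar>b - a\<bar> \<le> 2 * L" using assms(1,2) by (auto simp: confined_def)
  then have ab: "a = b"
    using D(1) m L dvd_imp_le_int[of "b - a" "int m"] by (auto split: if_splits)
  show ?thesis
  proof (cases "a = 0")
    case True
    then have im: "int m = 4 * L + 1" using m L by simp
    have "class_sum (4 * L + 1) f' r = class_sum (4 * L + 1) f (r - c)" for r
      using D(2) True ab by (simp add: im)
    then obtain d where "\<forall>x. f' x = f (x - d)"
      using translate_of_class_sums[OF f f' _ _ L, of c] assms(1,2) by (auto simp: confined_def)
    moreover have "(\<lambda>x. 0) \<in> lamp_configs" by (simp add: lamp_configs_def)
    ultimately show ?thesis
      unfolding lamplighter_conj_iff[OF f f'] using ab
      by (intro conjI exI[of _ d] bexI[of _ "\<lambda>x. 0"]) auto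
  next
    case False
    then have im: "int m = \<bar>a\<bar>" using m ab by simp
    define v where "v x = (f' x + f (x - c)) mod 2" for x
    have fin: "finite {x. f' x \<noteq> 0}" "finite {x. f (x - c) \<noteq> 0}"
      using f f' finite_support_shift by (auto simp: lamp_configs_def)
    then have "finite {x. v x \<noteq> 0}"
      by (rule_tac finite_subset[OF _ finite_UnI[OF fin]]) (auto simp: v_def)
    then have v: "v \<in> lamp_configs" by (auto simp: lamp_configs_def v_def)
    have "class_sum \<bar>a\<bar> v r = 0" for r
    proof -
      have "class_sum \<bar>a\<bar> v r = (class_sum \<bar>a\<bar> f' r + class_sum \<bar>a\<bar> f (r - c)) mod 2"
        unfolding v_def class_sum_add[OF fin] class_sum_shift ..
      also have "class_sum \<bar>a\<bar> f' r = class_sum \<bar>a\<bar> f (r - c)"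
        using D(2) ab im by simp
      finally show ?thesis by simp
    qed
    then obtain w where w: "w \<in> lamp_configs" "\<And>x. w x = (w (x - a) + v x) mod 2"
      using coboundary[OF v False] by blast
    have "(f' x + w (x - a)) mod 2 = (w x + f (x - c)) mod 2" for x
      unfolding w(2)[of x] v_def by presburger
    then show ?thesis
      unfolding lamplighter_conj_iff[OF f f'] using ab w(1) by auto
  qed
qed

lemma separating_quotient:
  assumes g: "g \<in> carrier lamplighter_group" and h: "h \<in> carrier lamplighter_group"
    and "confined L g" "confined L h" and L: "L \<ge> 0"
    and non: "h \<notin> conj_class lamplighter_group g"
  shows "\<exists>N. separates_conj lamplighter_group N g h
    \<and> card (rcosets\<^bsub>lamplighter_group\<^esub> N) \<le> 4 * 2 ^ nat (8 * L)"
proof -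
  obtain f a f' b where gh: "g = (f, a)" "h = (f', b)"
    and f: "f \<in> lamp_configs" and f': "f' \<in> lamp_configs"
    using g h by (auto simp: carrier_lamplighter)
  define m where "m = (if a = b \<and> a \<noteq> 0 then nat \<bar>a\<bar> else nat (4 * L + 1))"
  have m: "0 < m" "m \<le> nat (4 * L + 1)"
    using assms(3) L by (auto simp: m_def gh confined_def)
  interpret group_hom lamplighter_group "finite_lamplighter m" "reduce_mod m"
    by (rule reduce_mod_hom[OF m(1)])
  let ?N = "kernel lamplighter_group (finite_lamplighter m) (reduce_mod m)"
  have "reduce_mod m h \<otimes>\<^bsub>finite_lamplighter m\<^esub> reduce_mod m k
      \<noteq> reduce_mod m k \<otimes>\<^bsub>finite_lamplighter m\<^esub> reduce_mod m g"
    if "k \<in> carrier lamplighter_group" for k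
    using conj_of_reduce_mod_conj[OF _ _ L f f' m_def] assms(3,4) non that
    unfolding gh by (auto simp: carrier_lamplighter)
  note sep = separates_conj_kernel[OF order_finite_lamplighter(2)[OF m(1)] g h this]
  have "m * 2 ^ m \<le> 2 ^ m * (2 ^ m :: nat)"
    by (intro mult_right_mono) (auto intro: less_imp_le)
  also have "\<dots> = 2 ^ (2 * m)" by (simp add: power_add[symmetric] mult_2)
  also have "\<dots> \<le> 2 ^ (2 + nat (8 * L))"
    using m L by (intro power_increasing) auto
  also have "\<dots> = 4 * 2 ^ nat (8 * L)" by (simp add: power_add)
  finally show ?thesis
    using sep order_finite_lamplighter(1)[OF m(1)] by fastforce
qed

lemma confined_finite_set:
  assumes "finite T" "T \<subseteq> carrier lamplighter_group"
  shows "\<exists>C. \<forall>x\<in>T. confined (int C) x"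
  using assms
proof (induction T)
  case (insert x T)
  then obtain C where C: "\<forall>y\<in>T. confined (int C) y" by auto
  obtain f a where x: "x = (f, a)" and f: "f \<in> lamp_configs"
    using insert.prems by (auto simp: carrier_lamplighter)
  let ?A = "insert (nat \<bar>a\<bar>) ((\<lambda>y. nat \<bar>y\<bar>) ` {y. f y \<noteq> 0})"
  have "finite ?A" using f by (simp add: lamp_configs_def)
  then obtain D where D: "\<forall>y\<in>?A. y \<le> D" using finite_nat_set_iff_bounded_le by blast
  then have "confined (int D) x" by (force simp: x confined_def)
  with C have "\<forall>y\<in>insert x T. confined (int (max C D)) y"
    by (fastforce simp: confined_def)
  then show ?case by blast
qed auto

lemma conjugacy_separable_lamplighter: "conjugacy_separable lamplighter_group"
  unfolding conjugacy_separable_def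
proof (intro ballI impI)
  fix g h :: "(int \<Rightarrow> int) \<times> int"
  assume *: "g \<in> carrier lamplighter_group" "h \<in> carrier lamplighter_group"
    "h \<notin> conj_class lamplighter_group g"
  then obtain C where "confined (int C) g" "confined (int C) h"
    using confined_finite_set[of "{g, h}"] by auto
  with * show "\<exists>N. separates_conj lamplighter_group N g h"
    using separating_quotient[of g h "int C"] by auto
qed

section \<open>The growth of the conjugacy depth\<close>

text \<open>Left multiplication by a confined element moves the shift by at most \<open>C\<close> and widens the support
  by at most \<open>C\<close> on either side.\<close>

lemma confined_word:
  assumes "set w \<subseteq> carrier lamplighter_group" "\<And>x. x \<in> set w \<Longrightarrow> confined C x"
  shows "confined (C * int (length w)) (foldr (\<otimes>\<^bsub>lamplighter_group\<^esub>) w \<one>\<^bsub>lamplighter_group\<^esub>)"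
  using assms
proof (induction w)
  case Nil
  then show ?case by (simp add: one_lamplighter confined_def)
next
  case (Cons x w)
  obtain f a where x: "x = (f, a)" by force
  obtain g b where y: "foldr (\<otimes>\<^bsub>lamplighter_group\<^esub>) w \<one>\<^bsub>lamplighter_group\<^esub> = (g, b)" by force
  have fa: "\<bar>a\<bar> \<le> C" "\<And>z. f z \<noteq> 0 \<Longrightarrow> \<bar>z\<bar> \<le> C"
    using Cons.prems(2)[of x] by (auto simp: x confined_def)
  have gb: "\<bar>b\<bar> \<le> C * int (length w)" "\<And>z. g z \<noteq> 0 \<Longrightarrow> \<bar>z\<bar> \<le> C * int (length w)"
    using Cons by (auto simp: y confined_def)
  have len: "C * int (length (x # w)) = C + C * int (length w)"
    by (simp add: algebra_simps)
  have "\<bar>z\<bar> \<le> C + C * int (length w)" if "(f z + g (z - a)) mod 2 \<noteq> 0" for z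
  proof (cases "f z = 0")
    case True
    then have "g (z - a) \<noteq> 0" using that by auto
    then show ?thesis using gb(2) fa(1) by fastforce
  next
    case False
    then show ?thesis using fa(2) gb(1) by fastforce
  qed
  moreover have "\<bar>a + b\<bar> \<le> C + C * int (length w)" using fa(1) gb(1) by linarith
  ultimately show ?case
    unfolding len by (simp add: x y mult_lamplighter) (simp add: confined_def)
qed

lemma confined_word_length:
  assumes S: "finite_generating_set lamplighter_group S"
  shows "\<exists>C. \<forall>g\<in>carrier lamplighter_group. \<forall>n.
    word_length lamplighter_group S g \<le> n \<longrightarrow> confined (int (C * n)) g"
proof -
  interpret group lamplighter_group by (rule group_lamplighter_group)
  let ?T = "S \<union> m_inv lamplighter_group ` S"
  have T: "finite ?T" "?T \<subseteq> carrier lamplighter_group"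
    using S by (auto simp: finite_generating_set_def)
  then obtain C where C: "\<forall>x\<in>?T. confined (int C) x" using confined_finite_set by blast
  have "confined (int (C * n)) g"
    if g: "g \<in> carrier lamplighter_group" and n: "word_length lamplighter_group S g \<le> n" for g n
  proof -
    obtain w where w: "length w = word_length lamplighter_group S g" "set w \<subseteq> ?T"
      "foldr (\<otimes>\<^bsub>lamplighter_group\<^esub>) w \<one>\<^bsub>lamplighter_group\<^esub> = g"
      using word_of_word_length[OF S g] by blast
    have "confined (int C * int (length w)) g"
      using confined_word[of w "int C"] w T C by blast
    moreover have "int C * int (length w) \<le> int (C * n)"
      using n w(1) by (simp add: mult_left_mono)
    ultimately show ?thesis by (fastforce simp: confined_def)
  qed
  then show ?thesis by blast
qed

text \<open>The uniform bound also shows that the set of depths is finite, without which its \<open>Max\<close> would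
  be unspecified.\<close>

lemma Conj_fun_le:
  assumes "\<And>g h. \<lbrakk>g \<in> carrier G; h \<in> carrier G; h \<notin> conj_class G g;
      word_length G S g \<le> n; word_length G S h \<le> n\<rbrakk>
    \<Longrightarrow> \<exists>N. separates_conj G N g h \<and> card (rcosets\<^bsub>G\<^esub> N) \<le> B"
  shows "Conj_fun G S n \<le> B"
proof -
  let ?D = "{conj_depth G g h | g h. g \<in> carrier G \<and> h \<in> carrier G \<and> h \<notin> conj_class G g \<and>
     word_length G S g \<le> n \<and> word_length G S h \<le> n}"
  have "d \<le> B" if "d \<in> ?D" for d
  proof -
    from that obtain g h where "d = conj_depth G g h" "g \<in> carrier G" "h \<in> carrier G"
      "h \<notin> conj_class G g" "word_length G S g \<le> n" "word_length G S h \<le> n" by blast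
    with assms obtain N where d: "d = conj_depth G g h"
      and N: "separates_conj G N g h" "card (rcosets\<^bsub>G\<^esub> N) \<le> B"
      by metis
    have "conj_depth G g h \<le> card (rcosets\<^bsub>G\<^esub> N)"
      unfolding conj_depth_def using N(1) by (intro Least_le) blast
    with d N(2) show ?thesis by simp
  qed
  then have le: "\<forall>d\<in>insert 0 ?D. d \<le> B" by blast
  then have "finite (insert 0 ?D)"
    using finite_nat_set_iff_bounded_le by blast
  then show ?thesis
    unfolding Conj_fun_def using le by (subst Max_le_iff) auto
qed

lemma Conj_fun_lamplighter:
  assumes S: "finite_generating_set lamplighter_group S"
  shows "Conj_fun lamplighter_group S \<preceq> (\<lambda>n. 2 ^ (n ^ (n ^ 2)))"
proof -
  obtain C where C: "\<And>g n. \<lbrakk>g \<in> carrier lamplighter_group;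
      word_length lamplighter_group S g \<le> n\<rbrakk> \<Longrightarrow> confined (int (C * n)) g"
    using confined_word_length[OF S] by blast
  \<comment> \<open>The summand \<open>8 * C\<close> absorbs the exponent \<open>8 * C * n\<close>, the summand \<open>4\<close> the constant factor.\<close>
  define K where "K = 8 * C + 4"
  have "Conj_fun lamplighter_group S n \<le> K * 2 ^ ((K * n) ^ ((K * n) ^ 2))" for n
  proof -
    have "Conj_fun lamplighter_group S n \<le> 4 * 2 ^ nat (8 * int (C * n))"
      by (rule Conj_fun_le, rule separating_quotient) (auto intro: C simp del: of_nat_mult)
    also have "\<dots> = 4 * 2 ^ (8 * C * n)"
      by (simp add: nat_mult_distrib mult.assoc)
    also have "\<dots> \<le> K * 2 ^ ((K * n) ^ ((K * n) ^ 2))"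
    proof (intro mult_mono power_increasing)
      have "8 * C * n \<le> K * n" by (simp add: K_def)
      also have "\<dots> \<le> (K * n) ^ ((K * n) ^ 2)"
      proof (cases "n = 0")
        case False
        then have "0 < K * n" by (simp add: K_def)
        then show ?thesis by (intro self_le_power) auto
      qed simp
      finally show "8 * C * n \<le> (K * n) ^ ((K * n) ^ 2)" .
    qed (auto simp: K_def)
    finally show ?thesis .
  qed
  then show ?thesis unfolding growth_le_def by blast
qed

theorem corollary3p1:
  shows "conjugacy_separable lamplighter_group \<and>
    (\<forall>S. finite_generating_set lamplighter_group S \<longrightarrow>
       Conj_fun lamplighter_group S \<preceq> (\<lambda>n. 2 ^ (n ^ (n ^ 2))))"
  using conjugacy_separable_lamplighter Conj_fun_lamplighter by blast

end
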